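(* Let $\operatorname{opt}$ be a choice function. The normal form operator $\operatorname{norm}_{\operatorname{opt}}$ induced by $\operatorname{opt}$ is subtree perfect if and only if $\operatorname{opt}$ satisfies the conditioning property, the intersection property and the mixture property.
   Context: **Gambles.** $\Omega$ is a finite set (the possibility space); subsets of $\Omega$ are events; $\overline{A}=\Omega\setminus A$. $\mathcal{R}$ is an arbitrary set of rewards. A gamble is a function $X\colon\Omega\to\mathcal{R}$. For an event $E$ and a gamble $X$, $EX$ is the restriction of $X$ to $E$, and $\oplus$ combines partial maps with disjoint domains: if $E_1,\dots,E_n$ is a partition of $\Omega$, $\bigoplus_{i=1}^n E_iX_i$ is the gamble that equals $X_i$ on each $E_i$. For sets of gambles, $\bigoplus_{i=1}^n E_i\mathcal{X}_i=\{\bigoplus_{i=1}^n E_iX_i\colon X_i\in\mathcal{X}_i\}$; for an event $A$ and a gamble $Z$, $A\mathcal{X}\oplus\overline{A}Z=\{AX\oplus\overline{A}Z\colon X\in\mathcal{X}\}$. **Choice functions.** A choice function $\operatorname{opt}$ maps every non-empty finite set $\mathcal{X}$ of gambles and every non-empty event $A$ to a set $\operatorname{opt}(\mathcal{X}|A)$ with $\emptyset\neq\operatorname{opt}(\mathcal{X}|A)\subseteq\mathcal{X}$. **Decision trees.** A decision tree is a finite rooted tree whose leaves carry rewards in $\mathcal{R}$ and whose other nodes are decision nodes or chance nodes; the arcs out of a chance node are labelled by events forming a finite partition of $\Omega$. Each tree $T$ carries an event $\operatorname{ev}(T)$ (the intersection of all events on chance arcs that have preceded $T$). $T=\bigsqcup_{i=1}^n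 T_i$ means the root of $T$ is a decision node with subtrees $T_i$ at its children; then $\operatorname{ev}(T_i)=\operatorname{ev}(T)$. $T=\bigodot_{i=1}^n E_iT_i$ means the root is a chance node with $T_i$ attached by the arc labelled $E_i$; then $\operatorname{ev}(T_i)=\operatorname{ev}(T)\cap E_i$. For a node $N$ of $T$, $\operatorname{st}_N(T)$ is the subtree of $T$ at $N$ (remove all non-descendants of $N$), with $\operatorname{ev}(\operatorname{st}_N(T))$ the intersection of $\operatorname{ev}(T)$ with all events on chance arcs on the path from the root of $T$ to $N$. $T$ is consistent if $\operatorname{ev}(\operatorname{st}_N(T))\neq\emptyset$ for every node $N$ of $T$. For a set $\mathcal{T}$ of trees, $\operatorname{st}_N(\mathcal{T})=\{\operatorname{st}_N(T)\colon T\in\mathcal{T},\ N\text{ in }T\}$. **Normal form.** A normal form decision of $T$ is a subtree of $T$ (with the same root, and $\operatorname{ev}$ unchanged) obtained by keeping exactly one arc out of each reached decision node and all arcs out of each reached chance node; its nodes are regarded as nodes of $T$. $\operatorname{nfd}(T)$ is the set of all normal form decisions of $T$. The set of gambles $\operatorname{gamb}(T)$ is defined recursively: $\{r\}$ (constant gamble) if $T$ is a leaf with reward $r$; $\operatorname{gamb}(\bigodot_{i} E_iT_i)=\bigoplus_{i} E_i\operatorname{gamb}(T_i)$; $\operatorname{gamb}(\bigsqcup_i T_i)=\bigcup_i\operatorname{gamb}(T_i)$. For $U\in\operatorname{nfd}(T)$, $\operatorname{gamb}(U)$ is a singleton. A normal form operator maps each decision tree $T$ in its domain (which includes all consistent trees)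 to a subset of $\operatorname{nfd}(T)$. For a choice function $\operatorname{opt}$ and a tree $T$ with $\operatorname{ev}(T)\neq\emptyset$, $$\operatorname{norm}_{\operatorname{opt}}(T)=\{U\in\operatorname{nfd}(T)\colon\operatorname{gamb}(U)\subseteq\operatorname{opt}(\operatorname{gamb}(T)|\operatorname{ev}(T))\}.$$ A normal form operator $\operatorname{norm}$ is subtree perfect if for every consistent decision tree $T$ and every node $N$ which is in at least one element of $\operatorname{norm}(T)$, $\operatorname{st}_N(\operatorname{norm}(T))=\operatorname{norm}(\operatorname{st}_N(T))$. **$A$-consistency.** For a non-empty event $A$, a non-empty finite set $\mathcal{X}$ of gambles is $A$-consistent if for all $r\in\mathcal{R}$ and $X\in\mathcal{X}$ with $X^{-1}(r)\neq\emptyset$ one has $X^{-1}(r)\cap A\neq\emptyset$ (equivalently, there is a consistent decision tree $T$ with $\operatorname{ev}(T)=A$ and $\operatorname{gamb}(T)=\mathcal{X}$). A gamble $X$ is $A$-consistent if $\{X\}$ is. **Properties of $\operatorname{opt}$.** - Conditioning property: for every non-empty event $A$, every non-empty finite $A$-consistent set of gambles $\mathcal{X}$ and all $X,Y\in\mathcal{X}$ with $AX=AY$: if $X\in\operatorname{opt}(\mathcal{X}|A)$ then $Y\in\operatorname{opt}(\mathcal{X}|A)$. - Intersection property: for every event $A\neq\emptyset$ and non-empty finite $A$-consistent sets of gambles $\mathcal{Y}\subseteq\mathcal{X}$ with $\operatorname{opt}(\mathcal{X}|A)\cap\mathcal{Y}\neq\emptyset$: $\operatorname{opt}(\mathcal{Y}|A)=\operatorname{opt}(\mathcal{X}|A)\cap\mathcal{Y}$.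 - Mixture property: for all events $A,B$ with $A\cap B\neq\emptyset$ and $\overline{A}\cap B\neq\emptyset$, every $\overline{A}\cap B$-consistent gamble $Z$ and every non-empty finite $A\cap B$-consistent set of gambles $\mathcal{X}$: $\operatorname{opt}(A\mathcal{X}\oplus\overline{A}Z|B)=A\operatorname{opt}(\mathcal{X}|A\cap B)\oplus\overline{A}Z$. *)

theory Defs
  imports Main "HOL-Library.Finite_Map" "HOL-Library.Disjoint_Sets"
begin

text \<open>The possibility space and the set of rewards are the types \<open>'w\<close> (of class
  \<open>finite\<close> in the theorem) and \<open>'r\<close>.\<close>

type_synonym ('w, 'r) gamble = "'w \<Rightarrow> 'r"

text \<open>\<open>glue \<E> X\<close> is the gamble that equals \<open>X E\<close> on each \<open>E \<in> \<E>\<close>. It is meaningful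
  only if \<open>\<E>\<close> is a partition of the possibility space, and it is applied to such \<open>\<E>\<close> only.\<close>

definition glue :: "'w set set \<Rightarrow> ('w set \<Rightarrow> ('w, 'r) gamble) \<Rightarrow> ('w, 'r) gamble" where
  "glue \<E> X = (\<lambda>\<omega>. X (THE E. E \<in> \<E> \<and> \<omega> \<in> E) \<omega>)"

definition glue_sets :: "('w set, ('w, 'r) gamble set) fmap \<Rightarrow> ('w, 'r) gamble set" where
  "glue_sets m = {glue (fset (fmdom m)) X | X. \<forall>E \<X>. fmlookup m E = Some \<X> \<longrightarrow> X E \<in> \<X>}"

text \<open>\<open>mix A X Z\<close> is the two-block case \<open>A X \<oplus> (- A) Z\<close> of \<open>glue\<close>; it also
  makes sense if \<open>A\<close> or its complement is empty.\<close>

definition mix :: "'w set \<Rightarrow> ('w, 'r) gamble \<Rightarrow> ('w, 'r) gamble \<Rightarrow> ('w, 'r) gamble" where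
  "mix A X Z = (\<lambda>\<omega>. if \<omega> \<in> A then X \<omega> else Z \<omega>)"

definition mix_set :: "'w set \<Rightarrow> ('w, 'r) gamble set \<Rightarrow> ('w, 'r) gamble \<Rightarrow> ('w, 'r) gamble set" where
  "mix_set A \<X> Z = {mix A X Z | X. X \<in> \<X>}"

lemma glue_eq:
  assumes "partition_on UNIV \<E>" "E \<in> \<E>" "\<omega> \<in> E"
  shows "glue \<E> X \<omega> = X E \<omega>"
proof -
  have "(THE E. E \<in> \<E> \<and> \<omega> \<in> E) = E"
    using assms by (intro the_equality) (auto simp: partition_on_def disjoint_def)
  then show ?thesis by (simp add: glue_def)
qed

type_synonym ('w, 'r) choice = "('w, 'r) gamble set \<Rightarrow> 'w set \<Rightarrow> ('w, 'r) gamble set"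

definition choice_function :: "('w, 'r) choice \<Rightarrow> bool" where
  "choice_function opt \<longleftrightarrow>
     (\<forall>\<X> A. finite \<X> \<and> \<X> \<noteq> {} \<and> A \<noteq> {} \<longrightarrow> opt \<X> A \<noteq> {} \<and> opt \<X> A \<subseteq> \<X>)"

text \<open>The arcs out of a decision node carry arbitrary names, taken from \<open>nat\<close>, so that a node
  of a normal form decision can be identified with a node of the tree it is taken from. The arcs
  out of a chance node are identified by their events.\<close>

datatype ('w, 'r) tree =
    Leaf 'r
  | Decision "(nat, ('w, 'r) tree) fmap"
  | Chance "('w set, ('w, 'r) tree) fmap"

inductive well_formed :: "('w, 'r) tree \<Rightarrow> bool" where
  "well_formed (Leaf r)"
| "ts \<noteq> fmempty \<Longrightarrow> (\<forall>i t. fmlookup ts i = Some t \<longrightarrow> well_formed t) \<Longrightarrow>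
     well_formed (Decision ts)"
| "partition_on UNIV (fset (fmdom ts)) \<Longrightarrow> (\<forall>E t. fmlookup ts E = Some t \<longrightarrow> well_formed t) \<Longrightarrow>
     well_formed (Chance ts)"

text \<open>A decision tree carries the event \<open>ev T\<close>, the intersection of the events on the chance
  arcs that have preceded it.\<close>

type_synonym ('w, 'r) dtree = "('w, 'r) tree \<times> 'w set"

definition ev :: "('w, 'r) dtree \<Rightarrow> 'w set" where
  "ev T = snd T"

definition decision_tree :: "('w, 'r) dtree \<Rightarrow> bool" where
  "decision_tree T \<longleftrightarrow> well_formed (fst T)"

text \<open>A node is given by the sequence of arcs leading to it from the root.\<close>

type_synonym 'w node = "(nat + 'w set) list"

fun subtree_at :: "'w node \<Rightarrow> ('w, 'r) dtree \<Rightarrow> ('w, 'r) dtree option" where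
  "subtree_at [] T = Some T"
| "subtree_at (Inl i # N) (Decision ts, A) =
     (case fmlookup ts i of None \<Rightarrow> None | Some t \<Rightarrow> subtree_at N (t, A))"
| "subtree_at (Inr E # N) (Chance ts, A) =
     (case fmlookup ts E of None \<Rightarrow> None | Some t \<Rightarrow> subtree_at N (t, A \<inter> E))"
| "subtree_at _ _ = None"

definition nodes :: "('w, 'r) dtree \<Rightarrow> 'w node set" where
  "nodes T = {N. subtree_at N T \<noteq> None}"

definition st :: "'w node \<Rightarrow> ('w, 'r) dtree \<Rightarrow> ('w, 'r) dtree" where
  "st N T = the (subtree_at N T)"

definition st_set :: "'w node \<Rightarrow> ('w, 'r) dtree set \<Rightarrow> ('w, 'r) dtree set" where
  "st_set N \<T> = {st N T | T. T \<in> \<T> \<and> N \<in> nodes T}"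

definition consistent :: "('w, 'r) dtree \<Rightarrow> bool" where
  "consistent T \<longleftrightarrow> (\<forall>N \<in> nodes T. ev (st N T) \<noteq> {})"

text \<open>\<open>normal_form t u\<close>: \<open>u\<close> is obtained from \<open>t\<close> by keeping one arc out of each reached
  decision node, with its name, and all arcs out of each reached chance node.\<close>

inductive normal_form :: "('w, 'r) tree \<Rightarrow> ('w, 'r) tree \<Rightarrow> bool" where
  "normal_form (Leaf r) (Leaf r)"
| "fmlookup ts i = Some t \<Longrightarrow> normal_form t u \<Longrightarrow>
     normal_form (Decision ts) (Decision (fmupd i u fmempty))"
| "fmrel normal_form ts us \<Longrightarrow> normal_form (Chance ts) (Chance us)"

definition nfd :: "('w, 'r) dtree \<Rightarrow> ('w, 'r) dtree set" where
  "nfd T = {(u, ev T) | u. normal_form (fst T) u}"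

primrec tree_gambles :: "('w, 'r) tree \<Rightarrow> ('w, 'r) gamble set" where
  "tree_gambles (Leaf r) = {\<lambda>_. r}"
| "tree_gambles (Decision ts) = \<Union> (fmran' (fmmap tree_gambles ts))"
| "tree_gambles (Chance ts) = glue_sets (fmmap tree_gambles ts)"

definition gamb :: "('w, 'r) dtree \<Rightarrow> ('w, 'r) gamble set" where
  "gamb T = tree_gambles (fst T)"

type_synonym ('w, 'r) operator = "('w, 'r) dtree \<Rightarrow> ('w, 'r) dtree set"

definition normal_form_operator :: "('w, 'r) operator \<Rightarrow> bool" where
  "normal_form_operator norm \<longleftrightarrow>
     (\<forall>T. decision_tree T \<and> consistent T \<longrightarrow> norm T \<subseteq> nfd T)"

definition norm_opt :: "('w, 'r) choice \<Rightarrow> ('w, 'r) operator" where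
  "norm_opt opt T = {U \<in> nfd T. gamb U \<subseteq> opt (gamb T) (ev T)}"

lemma normal_form_operator_norm_opt: "normal_form_operator (norm_opt opt)"
  by (auto simp: normal_form_operator_def norm_opt_def)

definition subtree_perfect :: "('w, 'r) operator \<Rightarrow> bool" where
  "subtree_perfect norm \<longleftrightarrow>
     (\<forall>T N. decision_tree T \<and> consistent T \<and> (\<exists>U \<in> norm T. N \<in> nodes U) \<longrightarrow>
        st_set N (norm T) = norm (st N T))"

definition event_consistent :: "'w set \<Rightarrow> ('w, 'r) gamble set \<Rightarrow> bool" where
  "event_consistent A \<X> \<longleftrightarrow>
     (\<forall>r. \<forall>X \<in> \<X>. X -` {r} \<noteq> {} \<longrightarrow> X -` {r} \<inter> A \<noteq> {})"

definition conditioning_property :: "('w, 'r) choice \<Rightarrow> bool" where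
  "conditioning_property opt \<longleftrightarrow>
     (\<forall>A \<X>. A \<noteq> {} \<and> finite \<X> \<and> \<X> \<noteq> {} \<and> event_consistent A \<X> \<longrightarrow>
        (\<forall>X \<in> \<X>. \<forall>Y \<in> \<X>. (\<forall>\<omega> \<in> A. X \<omega> = Y \<omega>) \<longrightarrow> X \<in> opt \<X> A \<longrightarrow> Y \<in> opt \<X> A))"

definition intersection_property :: "('w, 'r) choice \<Rightarrow> bool" where
  "intersection_property opt \<longleftrightarrow>
     (\<forall>A \<X> \<Y>. A \<noteq> {} \<and> finite \<X> \<and> \<X> \<noteq> {} \<and> event_consistent A \<X> \<and>
        finite \<Y> \<and> \<Y> \<noteq> {} \<and> event_consistent A \<Y> \<and> \<Y> \<subseteq> \<X> \<and> opt \<X> A \<inter> \<Y> \<noteq> {} \<longrightarrow>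
        opt \<Y> A = opt \<X> A \<inter> \<Y>)"

definition mixture_property :: "('w, 'r) choice \<Rightarrow> bool" where
  "mixture_property opt \<longleftrightarrow>
     (\<forall>A B Z \<X>. A \<inter> B \<noteq> {} \<and> - A \<inter> B \<noteq> {} \<and> event_consistent (- A \<inter> B) {Z} \<and>
        finite \<X> \<and> \<X> \<noteq> {} \<and> event_consistent (A \<inter> B) \<X> \<longrightarrow>
        opt (mix_set A \<X> Z) B = mix_set A (opt \<X> (A \<inter> B)) Z)"

end

theory Submission
  imports Defs
begin

text \<open>Subtree perfectness need only be checked for the children of the root, since it then
  propagates along the path to a node. At a decision node it is an instance of the intersection
  property. At a chance node, fix an optimal gamble \<open>G\<close> of the whole tree and the arc \<open>E\<close>. The
  gambles of the tree that equal \<open>G\<close> outside \<open>E\<close> form a mixture of the gambles of the subtree,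
  so the intersection property restricts optimality to them, the mixture property transfers it
  to the subtree, and the conditioning property removes the dependence on values outside \<open>E\<close>.

  Conversely, every \<open>A\<close>-consistent set of gambles comes from a consistent tree, so each property
  is read off a tree with two arcs: a decision between \<open>\<Y>\<close> and \<open>\<X>\<close>, or a chance node with
  events \<open>A\<close> and \<open>- A\<close>. For the conditioning property both gambles are merged by such a chance
  node, which forces the subtree to declare both of them optimal.\<close>

section \<open>Finite maps, glued gambles and event consistency\<close>

lemma ex_fmap_on_finite:
  assumes "finite K"
  obtains m where "\<And>k. fmlookup m k = (if k \<in> K then Some (f k) else None)"
proof
  have "finite (dom (\<lambda>k. if k \<in> K then Some (f k) else None))"
    using assms by (rule rev_finite_subset) (auto split: if_splits)
  then show "fmlookup (Abs_fmap (\<lambda>k. if k \<in> K then Some (f k) else None)) k =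
      (if k \<in> K then Some (f k) else None)" for k
    by (simp add: Abs_fmap_inverse)
qed

lemma mix_in_mix_set: "X \<in> \<X> \<Longrightarrow> mix A X Z \<in> mix_set A \<X> Z"
  by (auto simp: mix_set_def)

lemma mix_UNIV [simp]: "mix UNIV X Z = X"
  by (auto simp: mix_def)

lemma mem_fmdom_iff: "E \<in> fset (fmdom m) \<longleftrightarrow> (\<exists>x. fmlookup m E = Some x)"
  by (metis fmdomE fmdomI)

text \<open>The blocks cover the space without overlap, so gambles can be chosen block by block,
  independently, and only their values on the own block survive the gluing. This pointwise criterion
  replaces \<open>glue\<close> and its \<open>THE\<close> in most later arguments.\<close>

lemma mem_glue_sets_iff:
  assumes "partition_on UNIV (fset (fmdom m))"
  shows "G \<in> glue_sets m \<longleftrightarrow>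
    (\<forall>E \<X>. fmlookup m E = Some \<X> \<longrightarrow> (\<exists>X \<in> \<X>. \<forall>\<omega> \<in> E. G \<omega> = X \<omega>))"
proof
  assume "G \<in> glue_sets m"
  then obtain X where X: "G = glue (fset (fmdom m)) X"
    "\<And>E \<X>. fmlookup m E = Some \<X> \<Longrightarrow> X E \<in> \<X>"
    by (auto simp: glue_sets_def)
  then show "\<forall>E \<X>. fmlookup m E = Some \<X> \<longrightarrow> (\<exists>X \<in> \<X>. \<forall>\<omega> \<in> E. G \<omega> = X \<omega>)"
    using glue_eq[OF assms] by (metis fmdomI)
next
  assume *: "\<forall>E \<X>. fmlookup m E = Some \<X> \<longrightarrow> (\<exists>X \<in> \<X>. \<forall>\<omega> \<in> E. G \<omega> = X \<omega>)"
  then have "\<forall>E. \<exists>X. \<forall>\<X>. fmlookup m E = Some \<X> \<longrightarrow> X \<in> \<X> \<and> (\<forall>\<omega> \<in> E. G \<omega> = X \<omega>)"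
    by (metis option.inject)
  then obtain X where X: "\<And>E \<X>. fmlookup m E = Some \<X> \<Longrightarrow> X E \<in> \<X> \<and> (\<forall>\<omega> \<in> E. G \<omega> = X E \<omega>)"
    by metis
  have "G \<omega> = glue (fset (fmdom m)) X \<omega>" for \<omega>
  proof -
    obtain E where E: "E \<in> fset (fmdom m)" "\<omega> \<in> E"
      using assms by (auto simp: partition_on_def)
    then obtain \<X> where "fmlookup m E = Some \<X>" by (auto simp: mem_fmdom_iff)
    then show ?thesis using X glue_eq[OF assms E] E(2) by metis
  qed
  then show "G \<in> glue_sets m"
    using X unfolding glue_sets_def by blast
qed

lemma event_consistent_iff:
  "event_consistent A \<X> \<longleftrightarrow> (\<forall>X \<in> \<X>. \<forall>\<omega>. \<exists>\<omega>' \<in> A. X \<omega>' = X \<omega>)"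
  by (fastforce simp: event_consistent_def)

lemma event_consistent_subset:
  "event_consistent A \<X> \<Longrightarrow> \<Y> \<subseteq> \<X> \<Longrightarrow> event_consistent A \<Y>"
  by (auto simp: event_consistent_def)

lemma choice_functionD:
  assumes "choice_function opt" "finite \<X>" "\<X> \<noteq> {}" "A \<noteq> {}"
  shows "opt \<X> A \<noteq> {}" "opt \<X> A \<subseteq> \<X>"
  using assms unfolding choice_function_def by simp_all

section \<open>Decision trees and their normal form decisions\<close>

lemma well_formed_Leaf [simp]: "well_formed (Leaf r)"
  by (rule well_formed.intros)

lemma well_formed_Decision_iff:
  "well_formed (Decision ts) \<longleftrightarrow>
     ts \<noteq> fmempty \<and> (\<forall>i t. fmlookup ts i = Some t \<longrightarrow> well_formed t)"
  by (subst well_formed.simps) auto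

lemma well_formed_Chance_iff:
  "well_formed (Chance ts) \<longleftrightarrow>
     partition_on UNIV (fset (fmdom ts)) \<and> (\<forall>E t. fmlookup ts E = Some t \<longrightarrow> well_formed t)"
  by (subst well_formed.simps) auto

lemma normal_form_Leaf_iff: "normal_form (Leaf r) u \<longleftrightarrow> u = Leaf r"
  by (subst normal_form.simps) auto

lemma normal_form_Decision_iff:
  "normal_form (Decision ts) v \<longleftrightarrow>
     (\<exists>i t u. fmlookup ts i = Some t \<and> normal_form t u \<and> v = Decision (fmupd i u fmempty))"
  by (subst normal_form.simps) auto

lemma normal_form_Chance_iff:
  "normal_form (Chance ts) v \<longleftrightarrow> (\<exists>us. v = Chance us \<and> fmrel normal_form ts us)"
  by (subst normal_form.simps) auto

lemma mem_tree_gambles_Decision: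
  "X \<in> tree_gambles (Decision ts) \<longleftrightarrow> (\<exists>i t. fmlookup ts i = Some t \<and> X \<in> tree_gambles t)"
  by (auto simp: Bex_def fmlookup_ran'_iff)

lemma tree_gambles_Decision_single [simp]:
  "tree_gambles (Decision (fmupd i u fmempty)) = tree_gambles u"
  by (auto simp: set_eq_iff mem_tree_gambles_Decision simp del: tree_gambles.simps split: if_splits)

lemma mem_tree_gambles_Chance:
  assumes "partition_on UNIV (fset (fmdom ts))"
  shows "X \<in> tree_gambles (Chance ts) \<longleftrightarrow>
    (\<forall>E t. fmlookup ts E = Some t \<longrightarrow> (\<exists>Y \<in> tree_gambles t. \<forall>\<omega> \<in> E. X \<omega> = Y \<omega>))"
  using assms by (auto simp: mem_glue_sets_iff)

declare tree_gambles.simps(2,3) [simp del]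

lemma fmrel_lookup1:
  "fmrel R m n \<Longrightarrow> fmlookup m k = Some x \<Longrightarrow> \<exists>y. fmlookup n k = Some y \<and> R x y"
  by (drule fmrelD[of _ _ _ k]) (auto simp: option_rel_Some1)

lemma fmrel_lookup2:
  "fmrel R m n \<Longrightarrow> fmlookup n k = Some y \<Longrightarrow> \<exists>x. fmlookup m k = Some x \<and> R x y"
  by (drule fmrelD[of _ _ _ k]) (auto simp: option_rel_Some2)

text \<open>Pruning leaves no choice open: a decision node keeps one arc, and a chance node glues
  the single gambles of its branches. Hence the inclusion in the definition of
  \<open>norm_opt\<close> amounts to the optimality of one gamble.\<close>

lemma tree_gambles_normal_form:
  assumes "normal_form t u" "well_formed t"
  shows "\<exists>X \<in> tree_gambles t. tree_gambles u = {X}"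
  using assms
proof (induction rule: normal_form.induct)
  case (1 r)
  then show ?case by simp
next
  case (2 ts i t u)
  then have "\<exists>X \<in> tree_gambles t. tree_gambles u = {X}"
    by (auto simp: well_formed_Decision_iff)
  with 2(1) show ?case
    unfolding tree_gambles_Decision_single Bex_def mem_tree_gambles_Decision by blast
next
  case (3 ts us)
  have dom: "fmdom us = fmdom ts"
    using fmrel_fmdom_eq[OF 3(1)] by simp
  have p: "partition_on UNIV (fset (fmdom ts))"
    using 3 by (simp add: well_formed_Chance_iff)
  then have p': "partition_on UNIV (fset (fmdom us))"
    by (simp add: dom)
  \<comment> \<open>The quantifiers are arranged so that one function \<open>X\<close> assigns to
    each arc the only gamble of its branch.\<close>
  have "\<forall>E. \<exists>X. \<forall>u. fmlookup us E = Some u \<longrightarrow>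
      tree_gambles u = {X} \<and> (\<forall>t. fmlookup ts E = Some t \<longrightarrow> X \<in> tree_gambles t)"
  proof
    fix E
    show "\<exists>X. \<forall>u. fmlookup us E = Some u \<longrightarrow>
      tree_gambles u = {X} \<and> (\<forall>t. fmlookup ts E = Some t \<longrightarrow> X \<in> tree_gambles t)"
    proof (cases "fmlookup us E")
      case (Some u)
      from fmrel_lookup2[OF 3(1) this] show ?thesis
        using Some 3(2) by (auto simp: well_formed_Chance_iff)
    qed simp
  qed
  then obtain X where X: "\<And>E u. fmlookup us E = Some u \<Longrightarrow> tree_gambles u = {X E}"
    "\<And>E u t. fmlookup us E = Some u \<Longrightarrow> fmlookup ts E = Some t \<Longrightarrow> X E \<in> tree_gambles t"
    by metis
  let ?G = "glue (fset (fmdom us)) X"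
  have G: "?G \<omega> = X E \<omega>" if "fmlookup us E = Some u" "\<omega> \<in> E" for E \<omega> u
    using that by (intro glue_eq[OF p']) (auto simp: mem_fmdom_iff)
  \<comment> \<open>Since the blocks cover the space, agreement on every block determines a gamble;
    this gives uniqueness.\<close>
  have eqG: "Y = ?G" if "\<And>E u \<omega>. fmlookup us E = Some u \<Longrightarrow> \<omega> \<in> E \<Longrightarrow> Y \<omega> = X E \<omega>" for Y
  proof
    fix \<omega>
    obtain E where E: "E \<in> fset (fmdom us)" "\<omega> \<in> E"
      using p' by (auto simp: partition_on_def)
    then obtain u where "fmlookup us E = Some u" by (auto simp: mem_fmdom_iff)
    then show "Y \<omega> = ?G \<omega>" using that G E by metis
  qed
  have "?G \<in> tree_gambles (Chance ts)"
    unfolding mem_tree_gambles_Chance[OF p]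
  proof (intro allI impI)
    fix E t assume t: "fmlookup ts E = Some t"
    then obtain u where "fmlookup us E = Some u"
      using fmrel_lookup1[OF 3(1)] by blast
    then show "\<exists>Y \<in> tree_gambles t. \<forall>\<omega> \<in> E. ?G \<omega> = Y \<omega>"
      using X(2) G t by blast
  qed
  moreover have "tree_gambles (Chance us) = {?G}"
  proof (intro equalityI subsetI; (elim singletonE)?)
    fix Y assume "Y \<in> tree_gambles (Chance us)"
    then have "Y = ?G"
      unfolding mem_tree_gambles_Chance[OF p'] by (intro eqG) (use X(1) in fastforce)
    then show "Y \<in> {?G}" by simp
  next
    fix Y assume "Y = ?G"
    then show "Y \<in> tree_gambles (Chance us)"
      unfolding mem_tree_gambles_Chance[OF p'] using X(1) G by auto
  qed
  ultimately show ?case by blast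
qed

text \<open>At each decision node one keeps an arc whose subtree yields the wanted gamble. At a
  chance node the branches are treated independently: branch \<open>E\<close> has to realise some
  gamble \<open>Y\<close> that agrees with \<open>X\<close> on \<open>E\<close>.\<close>

lemma ex_normal_form:
  assumes "well_formed t" "X \<in> tree_gambles t"
  shows "\<exists>u. normal_form t u \<and> tree_gambles u = {X}"
  using assms
proof (induction arbitrary: X rule: well_formed.induct)
  case (1 r)
  then show ?case by (simp add: normal_form_Leaf_iff)
next
  case (2 ts)
  then obtain i t where t: "fmlookup ts i = Some t" "X \<in> tree_gambles t"
    by (auto simp: mem_tree_gambles_Decision)
  then obtain u where "normal_form t u" "tree_gambles u = {X}"
    using 2 by blast
  then show ?case
    using t by (intro exI[of _ "Decision (fmupd i u fmempty)"])
      (auto simp: normal_form_Decision_iff)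
next
  case (3 ts)
  have wf: "well_formed (Chance ts)"
    using 3 by (simp add: well_formed_Chance_iff)
  have "\<forall>E. \<exists>u. \<forall>t. fmlookup ts E = Some t \<longrightarrow>
      normal_form t u \<and> (\<exists>Y. tree_gambles u = {Y} \<and> (\<forall>\<omega> \<in> E. X \<omega> = Y \<omega>))"
  proof
    fix E
    show "\<exists>u. \<forall>t. fmlookup ts E = Some t \<longrightarrow>
      normal_form t u \<and> (\<exists>Y. tree_gambles u = {Y} \<and> (\<forall>\<omega> \<in> E. X \<omega> = Y \<omega>))"
    proof (cases "fmlookup ts E")
      case (Some t)
      then obtain Y where "Y \<in> tree_gambles t" "\<forall>\<omega> \<in> E. X \<omega> = Y \<omega>"
        using 3(3) unfolding mem_tree_gambles_Chance[OF 3(1)] by blast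
      then show ?thesis
        using 3(2) Some by (metis option.inject)
    qed simp
  qed
  then obtain f where f: "\<And>E t. fmlookup ts E = Some t \<Longrightarrow>
      normal_form t (f E) \<and> (\<exists>Y. tree_gambles (f E) = {Y} \<and> (\<forall>\<omega> \<in> E. X \<omega> = Y \<omega>))"
    by metis
  let ?us = "fmmap_keys (\<lambda>E t. f E) ts"
  have "fmrel normal_form ts ?us"
  proof (rule fmrelI)
    fix E show "rel_option normal_form (fmlookup ts E) (fmlookup ?us E)"
      using f by (cases "fmlookup ts E") auto
  qed
  then have nf: "normal_form (Chance ts) (Chance ?us)"
    by (simp add: normal_form_Chance_iff)
  have p': "partition_on UNIV (fset (fmdom ?us))"
    using 3(1) by simp
  have "X \<in> tree_gambles (Chance ?us)"
    unfolding mem_tree_gambles_Chance[OF p']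
  proof (intro allI impI)
    fix E u assume "fmlookup ?us E = Some u"
    then obtain t where "fmlookup ts E = Some t" "u = f E" by auto
    then show "\<exists>Y \<in> tree_gambles u. \<forall>\<omega> \<in> E. X \<omega> = Y \<omega>"
      using f by blast
  qed
  \<comment> \<open>\<open>X\<close> is among the gambles of the pruned tree, and a pruned tree has
    only one gamble.\<close>
  then show ?case
    using nf tree_gambles_normal_form[OF nf wf] by auto
qed

lemma tree_gambles_nonempty: "well_formed t \<Longrightarrow> tree_gambles t \<noteq> {}"
proof (induction rule: well_formed.induct)
  case (1 r)
  then show ?case by simp
next
  case (2 ts)
  then obtain i t where "fmlookup ts i = Some t"
    by (metis fmap_ext fmempty_lookup not_None_eq)
  with 2 show ?case by (metis mem_tree_gambles_Decision all_not_in_conv)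
next
  case (3 ts)
  then have "\<exists>X. \<forall>E t. fmlookup ts E = Some t \<longrightarrow> X E \<in> tree_gambles t"
    by (intro choice) (metis all_not_in_conv option.inject)
  then obtain X where X: "\<And>E t. fmlookup ts E = Some t \<Longrightarrow> X E \<in> tree_gambles t"
    by blast
  have "glue (fset (fmdom ts)) X \<in> tree_gambles (Chance ts)"
    unfolding mem_tree_gambles_Chance[OF 3(1)] using X glue_eq[OF 3(1)]
    by (meson fmdomI)
  then show ?case by blast
qed

text \<open>Only finitely many rewards occur in a tree, so all its gambles take values in one finite
  set \<open>R\<close>; a finite possibility space admits finitely many functions into
  \<open>R\<close>.\<close>

lemma finite_tree_gambles:
  fixes t :: "('w::finite, 'r) tree"
  assumes "well_formed t"
  shows "finite (tree_gambles t)"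
proof -
  have "\<exists>R. finite R \<and> (\<forall>X \<in> tree_gambles t. \<forall>\<omega>. X \<omega> \<in> R)"
    using assms
  proof (induction rule: well_formed.induct)
    case (1 r)
    then show ?case by (intro exI[of _ "{r}"]) simp
  next
    case (2 ts)
    then have "\<forall>t \<in> fmran' ts. \<exists>R. finite R \<and> (\<forall>X \<in> tree_gambles t. \<forall>\<omega>. X \<omega> \<in> R)"
      by (auto simp: fmlookup_ran'_iff)
    then obtain R where R: "\<forall>t \<in> fmran' ts. finite (R t) \<and> (\<forall>X \<in> tree_gambles t. \<forall>\<omega>. X \<omega> \<in> R t)"
      by metis
    then have "finite (\<Union>t \<in> fmran' ts. R t)"
      by (auto simp: fmran'_alt_def)
    moreover have "X \<omega> \<in> (\<Union>t \<in> fmran' ts. R t)" if "X \<in> tree_gambles (Decision ts)" for X \<omega>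
      using that R by (auto simp: mem_tree_gambles_Decision intro: fmran'I)
    ultimately show ?case by blast
  next
    case (3 ts)
    then have "\<forall>t \<in> fmran' ts. \<exists>R. finite R \<and> (\<forall>X \<in> tree_gambles t. \<forall>\<omega>. X \<omega> \<in> R)"
      by (auto simp: fmlookup_ran'_iff)
    then obtain R where R: "\<forall>t \<in> fmran' ts. finite (R t) \<and> (\<forall>X \<in> tree_gambles t. \<forall>\<omega>. X \<omega> \<in> R t)"
      by metis
    then have "finite (\<Union>t \<in> fmran' ts. R t)"
      by (auto simp: fmran'_alt_def)
    moreover have "X \<omega> \<in> (\<Union>t \<in> fmran' ts. R t)" if X: "X \<in> tree_gambles (Chance ts)" for X \<omega>
    proof -
      obtain E where "E \<in> fset (fmdom ts)" "\<omega> \<in> E"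
        using 3(1) by (auto simp: partition_on_def)
      then obtain t where t: "fmlookup ts E = Some t" "\<omega> \<in> E" by (auto simp: mem_fmdom_iff)
      then obtain Y where "Y \<in> tree_gambles t" "X \<omega> = Y \<omega>"
        using X unfolding mem_tree_gambles_Chance[OF 3(1)] by blast
      then show ?thesis using R fmran'I[OF t(1)] by auto
    qed
    ultimately show ?case by blast
  qed
  then obtain R where R: "finite R" "\<forall>X \<in> tree_gambles t. \<forall>\<omega>. X \<omega> \<in> R" by blast
  have "finite (UNIV \<rightarrow>\<^sub>E R :: ('w \<Rightarrow> 'r) set)"
    using R(1) by (intro finite_PiE) auto
  then show ?thesis
    by (rule rev_finite_subset) (use R(2) in auto)
qed

section \<open>Nodes and consistency\<close>

text \<open>Splits off the first arc of a path uniformly for both kinds of nodes, so that later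
  inductions need not distinguish them.\<close>

lemma subtree_at_Cons:
  "subtree_at (a # N) T = Option.bind (subtree_at [a] T) (subtree_at N)"
proof (cases T)
  case (Pair t A)
  then show ?thesis by (cases a; cases t) (auto split: option.splits)
qed

lemma subtree_at_single_cases:
  assumes "subtree_at [a] (t, A) = Some S"
  obtains ts i s where "a = Inl i" "t = Decision ts" "fmlookup ts i = Some s" "S = (s, A)"
  | ts E s where "a = Inr E" "t = Chance ts" "fmlookup ts E = Some s" "S = (s, A \<inter> E)"
  using assms by (cases a; cases t) (auto split: option.splits)

lemma consistent_iff: "consistent T \<longleftrightarrow> (\<forall>N S. subtree_at N T = Some S \<longrightarrow> snd S \<noteq> {})"
  by (simp add: consistent_def nodes_def st_def ev_def)
    (metis option.sel option.collapse option.distinct(1) split_pairs)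

lemma consistent_nonempty: "consistent (t, A) \<Longrightarrow> A \<noteq> {}"
  unfolding consistent_iff by (metis snd_conv subtree_at.simps(1))

text \<open>Every node is the root or lies in the subtree below a first arc, so consistency is
  checked at the root and in the children.\<close>

lemma consistent_arcI:
  assumes "A \<noteq> {}" "\<And>a S. subtree_at [a] (t, A) = Some S \<Longrightarrow> consistent S"
  shows "consistent (t, A)"
  unfolding consistent_iff
proof (intro allI impI)
  fix N S assume "subtree_at N (t, A) = Some S"
  then show "snd S \<noteq> {}"
  proof (cases N)
    case (Cons a M)
    then show ?thesis
      using \<open>subtree_at N (t, A) = Some S\<close> assms(2)
      unfolding consistent_iff Cons subtree_at_Cons[of a M] bind_eq_Some_conv by blast
  qed (use assms(1) in auto)
qed

lemma consistent_DecisionI: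
  assumes "A \<noteq> {}" "\<And>i t. fmlookup ts i = Some t \<Longrightarrow> consistent (t, A)"
  shows "consistent (Decision ts, A)"
  using assms by (intro consistent_arcI) (auto elim!: subtree_at_single_cases)

lemma consistent_ChanceI:
  assumes "A \<noteq> {}" "\<And>E t. fmlookup ts E = Some t \<Longrightarrow> consistent (t, A \<inter> E)"
  shows "consistent (Chance ts, A)"
  using assms by (intro consistent_arcI) (auto elim!: subtree_at_single_cases)

lemma consistent_Leaf: "A \<noteq> {} \<Longrightarrow> consistent (Leaf r, A)"
  by (rule consistent_arcI) (auto elim: subtree_at_single_cases)

lemma consistent_arcD:
  assumes "consistent T" "subtree_at [a] T = Some S"
  shows "consistent S"
  unfolding consistent_iff
proof (intro allI impI)
  fix N V assume "subtree_at N S = Some V"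
  then have "subtree_at (a # N) T = Some V"
    by (simp add: subtree_at_Cons[of a N] assms(2))
  then show "snd V \<noteq> {}"
    using assms(1) unfolding consistent_iff by blast
qed

lemma decision_tree_arcD:
  assumes "decision_tree T" "subtree_at [a] T = Some S"
  shows "decision_tree S"
proof (cases T)
  case (Pair t A)
  show ?thesis
    using assms(2)[unfolded Pair] assms(1) Pair
    by (elim subtree_at_single_cases)
      (auto simp: decision_tree_def well_formed_Decision_iff well_formed_Chance_iff)
qed

lemma consistent_DecisionD:
  "consistent (Decision ts, A) \<Longrightarrow> fmlookup ts i = Some t \<Longrightarrow> consistent (t, A)"
  by (rule consistent_arcD[of _ "Inl i"]) auto

lemma consistent_ChanceD:
  "consistent (Chance ts, A) \<Longrightarrow> fmlookup ts E = Some t \<Longrightarrow> consistent (t, A \<inter> E)"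
  by (rule consistent_arcD[of _ "Inr E"]) auto

text \<open>At a chance node, the value of \<open>X\<close> at \<omega> in \<open>E\<close> is a
  value of a gamble \<open>Y\<close> of the branch. By induction \<open>Y\<close> also takes it at a
  point of \<open>A \<inter> E\<close>, where \<open>X\<close> and \<open>Y\<close> agree.
  \<open>ex_tree_gambles\<close> is the converse.\<close>

lemma event_consistent_tree_gambles:
  assumes "well_formed t" "consistent (t, A)"
  shows "event_consistent A (tree_gambles t)"
  using assms
proof (induction arbitrary: A rule: well_formed.induct)
  case (1 r)
  then show ?case using consistent_nonempty[OF 1] by (auto simp: event_consistent_iff)
next
  case (2 ts)
  show ?case unfolding event_consistent_iff
  proof (intro ballI allI)
    fix X \<omega> assume "X \<in> tree_gambles (Decision ts)"
    then obtain i t where t: "fmlookup ts i = Some t" "X \<in> tree_gambles t"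
      by (auto simp: mem_tree_gambles_Decision)
    then have "event_consistent A (tree_gambles t)"
      using 2 consistent_DecisionD by blast
    then show "\<exists>\<omega>' \<in> A. X \<omega>' = X \<omega>"
      using t(2) by (auto simp: event_consistent_iff)
  qed
next
  case (3 ts)
  show ?case unfolding event_consistent_iff
  proof (intro ballI allI)
    fix X \<omega> assume X: "X \<in> tree_gambles (Chance ts)"
    obtain E where "E \<in> fset (fmdom ts)" "\<omega> \<in> E"
      using 3(1) by (auto simp: partition_on_def)
    then obtain t where t: "fmlookup ts E = Some t" "\<omega> \<in> E" by (auto simp: mem_fmdom_iff)
    then obtain Y where Y: "Y \<in> tree_gambles t" "\<forall>\<omega> \<in> E. X \<omega> = Y \<omega>"
      using X unfolding mem_tree_gambles_Chance[OF 3(1)] by blast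
    have "event_consistent (A \<inter> E) (tree_gambles t)"
      using 3 t consistent_ChanceD by blast
    then obtain \<omega>' where "\<omega>' \<in> A \<inter> E" "Y \<omega>' = Y \<omega>"
      using Y(1) by (auto simp: event_consistent_iff)
    then show "\<exists>\<omega>' \<in> A. X \<omega>' = X \<omega>"
      using Y(2) t(2) by (metis IntD1 IntD2)
  qed
qed

section \<open>Reduction of subtree perfectness to single arcs\<close>

lemma st_set_Nil [simp]: "st_set [] \<T> = \<T>"
  by (auto simp: st_set_def st_def nodes_def)

lemma mem_st_set_iff: "S \<in> st_set N \<T> \<longleftrightarrow> (\<exists>T \<in> \<T>. subtree_at N T = Some S)"
  by (force simp: st_set_def st_def nodes_def)

lemma st_set_Cons: "st_set (a # N) \<T> = st_set N (st_set [a] \<T>)"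
  unfolding set_eq_iff mem_st_set_iff Bex_def subtree_at_Cons[of a N] bind_eq_Some_conv by blast

text \<open>Arcs keep their names under pruning, so a child in a normal form decision is also a
  child in the tree.\<close>

lemma subtree_at_nfd:
  assumes "U \<in> nfd T" "subtree_at [a] U = Some V"
  shows "\<exists>S. subtree_at [a] T = Some S"
proof (cases T)
  case (Pair t A)
  then obtain u where u: "U = (u, A)" "normal_form t u"
    using assms(1) by (auto simp: nfd_def ev_def)
  from assms(2)[unfolded u(1)] show ?thesis
  proof (cases rule: subtree_at_single_cases)
    case (1 ts i s)
    then show ?thesis using u(2) Pair
      by (cases t) (auto simp: normal_form_Leaf_iff normal_form_Decision_iff
          normal_form_Chance_iff split: if_splits)
  next
    case (2 ts E s)
    then show ?thesis using u(2) Pair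
      by (cases t) (auto simp: normal_form_Leaf_iff normal_form_Decision_iff
          normal_form_Chance_iff dest: fmrel_lookup2)
  qed
qed

text \<open>Induction along the path. The decision \<open>U\<close> that contains the node is cut at
  the first arc; the remainder \<open>V\<close> must again be selected by \<open>norm\<close> before
  the induction hypothesis applies to the child \<open>S\<close>.\<close>

lemma subtree_perfectI:
  assumes nf: "normal_form_operator norm"
  and arc: "\<And>T a S U V. decision_tree T \<Longrightarrow> consistent T \<Longrightarrow> subtree_at [a] T = Some S \<Longrightarrow>
      U \<in> norm T \<Longrightarrow> subtree_at [a] U = Some V \<Longrightarrow> st_set [a] (norm T) = norm S"
  shows "subtree_perfect norm"
  unfolding subtree_perfect_def
proof (intro allI impI)
  fix T N
  assume "decision_tree T \<and> consistent T \<and> (\<exists>U \<in> norm T. N \<in> nodes U)"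
  then show "st_set N (norm T) = norm (st N T)"
  proof (induction N arbitrary: T)
    case Nil
    then show ?case by (simp add: st_def)
  next
    case (Cons a N)
    then obtain U W where U: "U \<in> norm T" "subtree_at (a # N) U = Some W"
      by (auto simp: nodes_def)
    then obtain V where V: "subtree_at [a] U = Some V" "subtree_at N V = Some W"
      by (auto simp: subtree_at_Cons[of a N] bind_eq_Some_conv)
    have "U \<in> nfd T"
      using nf U(1) Cons.prems unfolding normal_form_operator_def by blast
    then obtain S where S: "subtree_at [a] T = Some S"
      using V(1) subtree_at_nfd by blast
    have eq: "st_set [a] (norm T) = norm S"
      using arc Cons.prems S U(1) V(1) by blast
    \<comment> \<open>The arc condition itself shows that \<open>V\<close> is selected in the
      child.\<close>
    have "V \<in> norm S"
      unfolding eq[symmetric] mem_st_set_iff using U(1) V(1) by blast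
    moreover have "N \<in> nodes V"
      using V(2) by (simp add: nodes_def)
    moreover have "decision_tree S" "consistent S"
      using Cons.prems S decision_tree_arcD consistent_arcD by blast+
    ultimately have "st_set N (norm S) = norm (st N S)"
      using Cons.IH by blast
    then show ?case
      by (simp add: st_set_Cons[of a N] eq st_def subtree_at_Cons[of a N] S)
  qed
qed

lemma subtree_perfectD:
  assumes "subtree_perfect norm" "decision_tree T" "consistent T" "U \<in> norm T" "N \<in> nodes U"
    "subtree_at N T = Some S"
  shows "st_set N (norm T) = norm S"
proof -
  have "st N T = S" using assms(6) by (simp add: st_def)
  then show ?thesis using assms unfolding subtree_perfect_def by blast
qed

lemma mem_norm_opt_iff:
  "U \<in> norm_opt opt (t, A) \<longleftrightarrow>
    (\<exists>u. U = (u, A) \<and> normal_form t u \<and> tree_gambles u \<subseteq> opt (tree_gambles t) A)"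
  by (auto simp: norm_opt_def nfd_def gamb_def ev_def)

text \<open>The subtrees obtained are normal form decisions of \<open>t\<close>, but they are judged
  against all gambles of the decision node. The difference to \<open>norm_opt opt (t, A)\<close> is
  thus a difference of option sets under the same event.\<close>

lemma mem_st_set_norm_opt_Decision:
  "S \<in> st_set [Inl i] (norm_opt opt (Decision ts, A)) \<longleftrightarrow>
    (\<exists>t u. fmlookup ts i = Some t \<and> S = (u, A) \<and> normal_form t u \<and>
      tree_gambles u \<subseteq> opt (tree_gambles (Decision ts)) A)" (is "?L \<longleftrightarrow> ?R")
proof
  assume ?L
  then obtain U where "U \<in> norm_opt opt (Decision ts, A)" "subtree_at [Inl i] U = Some S"
    by (auto simp: mem_st_set_iff)
  then show ?R
    by (auto simp: mem_norm_opt_iff normal_form_Decision_iff split: if_splits)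
next
  assume ?R
  then obtain t u where u: "fmlookup ts i = Some t" "S = (u, A)" "normal_form t u"
      "tree_gambles u \<subseteq> opt (tree_gambles (Decision ts)) A"
    by blast
  have "normal_form (Decision ts) (Decision (fmupd i u fmempty))"
    using u by (auto simp: normal_form_Decision_iff)
  then have "(Decision (fmupd i u fmempty), A) \<in> norm_opt opt (Decision ts, A)"
    using u(4) by (simp add: mem_norm_opt_iff)
  moreover have "subtree_at [Inl i] (Decision (fmupd i u fmempty), A) = Some S"
    using u(2) by simp
  ultimately show ?L
    unfolding mem_st_set_iff by blast
qed

section \<open>The three properties imply subtree perfectness\<close>

text \<open>The assumption \<open>ne\<close> says that some gamble of \<open>t\<close> is optimal in
  the whole tree, which is the premise of the intersection property.\<close>

lemma st_set_norm_opt_Decision: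
  fixes ts :: "(nat, ('w::finite, 'r) tree) fmap"
  assumes int: "intersection_property opt"
    and wf: "well_formed (Decision ts)" and con: "consistent (Decision ts, A)"
    and t: "fmlookup ts i = Some t"
    and ne: "st_set [Inl i] (norm_opt opt (Decision ts, A)) \<noteq> {}"
  shows "st_set [Inl i] (norm_opt opt (Decision ts, A)) = norm_opt opt (t, A)"
proof -
  let ?X = "tree_gambles (Decision ts)" and ?Y = "tree_gambles t"
  have wft: "well_formed t" using wf t by (auto simp: well_formed_Decision_iff)
  have cont: "consistent (t, A)" using con t by (rule consistent_DecisionD)
  have sub: "?Y \<subseteq> ?X"
    using t unfolding subset_iff mem_tree_gambles_Decision by blast
  obtain u where u: "normal_form t u" "tree_gambles u \<subseteq> opt ?X A"
    using ne t by (auto simp: set_eq_iff mem_st_set_norm_opt_Decision)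
  then have "opt ?X A \<inter> ?Y \<noteq> {}"
    using tree_gambles_normal_form[OF u(1) wft] by auto
  then have eq: "opt ?Y A = opt ?X A \<inter> ?Y"
    using int sub consistent_nonempty[OF con] finite_tree_gambles[OF wf] finite_tree_gambles[OF wft]
      tree_gambles_nonempty[OF wf] tree_gambles_nonempty[OF wft]
      event_consistent_tree_gambles[OF wf con] event_consistent_tree_gambles[OF wft cont]
    unfolding intersection_property_def by blast
  have "tree_gambles u \<subseteq> opt ?X A \<longleftrightarrow> tree_gambles u \<subseteq> opt ?Y A" if "normal_form t u" for u
    using tree_gambles_normal_form[OF that wft] eq by auto
  then show ?thesis
    using t by (auto simp: set_eq_iff mem_st_set_norm_opt_Decision mem_norm_opt_iff)
qed

text \<open>The chance node argument at the level of gambles; normal form decisions enter only in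
  \<open>st_set_norm_opt_Chance\<close>.\<close>

lemma mix_mem_opt_Chance_iff:
  fixes ts :: "('w::finite set, ('w, 'r) tree) fmap"
  assumes opt: "choice_function opt" and cond: "conditioning_property opt"
    and int: "intersection_property opt" and mixt: "mixture_property opt"
    and wf: "well_formed (Chance ts)" and con: "consistent (Chance ts, A)"
    and t: "fmlookup ts E = Some t"
    and G: "G \<in> opt (tree_gambles (Chance ts)) A" and Y: "Y \<in> tree_gambles t"
  shows "mix E Y G \<in> opt (tree_gambles (Chance ts)) A \<longleftrightarrow> Y \<in> opt (tree_gambles t) (A \<inter> E)"
proof -
  let ?X = "tree_gambles (Chance ts)" and ?Y = "tree_gambles t"
  have p: "partition_on UNIV (fset (fmdom ts))"
    using wf by (simp add: well_formed_Chance_iff)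
  note memX = mem_tree_gambles_Chance[OF p]
  have wft: "well_formed s" if "fmlookup ts F = Some s" for F s
    using wf that by (auto simp: well_formed_Chance_iff)
  have cont: "event_consistent (A \<inter> F) (tree_gambles s)" if "fmlookup ts F = Some s" for F s
    using event_consistent_tree_gambles[OF wft consistent_ChanceD[OF con]] that by blast
  have ne: "A \<inter> F \<noteq> {}" if "fmlookup ts F = Some s" for F s
    using consistent_nonempty[OF consistent_ChanceD[OF con that]] .
  have disj: "F = E \<or> F \<inter> E = {}" if "fmlookup ts F = Some s" for F s
    using p fmdomI[OF that] fmdomI[OF t] by (auto simp: partition_on_def disjoint_def)
  have block: "\<exists>F s. fmlookup ts F = Some s \<and> \<omega> \<in> F" for \<omega>
  proof -
    obtain F where "F \<in> fset (fmdom ts)" "\<omega> \<in> F" using p by (auto simp: partition_on_def)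
    then show ?thesis by (auto simp: mem_fmdom_iff)
  qed
  have A: "A \<noteq> {}" by (rule consistent_nonempty[OF con])
  have X: "finite ?X" "?X \<noteq> {}" "event_consistent A ?X"
    using finite_tree_gambles[OF wf] tree_gambles_nonempty[OF wf]
      event_consistent_tree_gambles[OF wf con] by simp_all
  have Ys: "finite ?Y" "?Y \<noteq> {}"
    using finite_tree_gambles[OF wft[OF t]] tree_gambles_nonempty[OF wft[OF t]] by simp_all
  note optX = choice_functionD(2)[OF opt X(1,2) A]
  note optY = choice_functionD(2)[OF opt Ys ne[OF t]]
  show ?thesis
  \<comment> \<open>The mixture property requires that \<open>A\<close> meet the complement of
    \<open>E\<close>. Otherwise any other block would miss \<open>A\<close>, against consistency; so
    \<open>E\<close> is the only block and the tree has the same gambles as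
    \<open>t\<close>.\<close>
  proof (cases "- E \<inter> A = {}")
    case True
    have "F = E" if "fmlookup ts F = Some s" for F s
      using disj[OF that] ne[OF that] True by blast
    then have E: "E = UNIV" using block by blast
    have only: "fmlookup ts F = Some s \<longleftrightarrow> F = UNIV \<and> s = t" for F s
      using t E \<open>\<And>s F. fmlookup ts F = Some s \<Longrightarrow> F = E\<close> by (metis option.inject)
    have "?X = ?Y"
    proof (rule set_eqI)
      fix H
      have "H \<in> ?X \<longleftrightarrow> (\<exists>Y \<in> ?Y. \<forall>\<omega>. H \<omega> = Y \<omega>)"
        unfolding memX by (simp add: only)
      then show "H \<in> ?X \<longleftrightarrow> H \<in> ?Y"
        by (simp add: fun_eq_iff[symmetric])
    qed
    then show ?thesis using E by simp
  next
    case False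
    then obtain \<omega>0 where w0: "\<omega>0 \<in> - E \<inter> A" by blast
    \<comment> \<open>\<open>G\<close> itself may fail to be consistent with
      \<open>- E \<inter> A\<close>, since on \<open>E\<close> it can take values not taken there.
      On \<open>E\<close> it is therefore overwritten by the constant value at
      \<open>\<omega>0\<close>, a point of \<open>- E \<inter> A\<close>; by \<open>mixZ\<close> the
      mixtures stay the same.\<close>
    define Z where "Z = mix E (\<lambda>_. G \<omega>0) G"
    have mixZ: "mix E Y' Z = mix E Y' G" for Y'
      by (auto simp: Z_def mix_def)
    have GX: "G \<in> ?X" using G optX by blast
    have Zcon: "event_consistent (- E \<inter> A) {Z}"
      unfolding event_consistent_iff
    proof (intro ballI allI; elim singletonE)
      fix X \<omega> assume "X = Z"
      have "\<exists>\<omega>' \<in> - E \<inter> A. Z \<omega>' = Z \<omega>"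
      proof (cases "\<omega> \<in> E")
        case True
        then show ?thesis using w0 by (intro bexI[of _ \<omega>0]) (auto simp: Z_def mix_def)
      next
        case False
        obtain F s where F: "fmlookup ts F = Some s" "\<omega> \<in> F" using block by blast
        obtain Y' where Y': "Y' \<in> tree_gambles s" "\<forall>\<omega> \<in> F. G \<omega> = Y' \<omega>"
          using GX F(1) unfolding memX by blast
        obtain \<omega>' where "\<omega>' \<in> A \<inter> F" "Y' \<omega>' = Y' \<omega>"
          using cont[OF F(1)] Y'(1) unfolding event_consistent_iff by blast
        moreover have "F \<inter> E = {}" using disj[OF F(1)] F(2) False by blast
        ultimately show ?thesis
          using F(2) Y'(2) by (intro bexI[of _ \<omega>']) (auto simp: Z_def mix_def)
      qed
      with \<open>X = Z\<close> show "\<exists>\<omega>' \<in> - E \<inter> A. X \<omega>' = X \<omega>" by simp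
    qed
    \<comment> \<open>These are the gambles of the tree that equal \<open>G\<close> outside
      \<open>E\<close>. As \<open>G\<close> is one of them, optimality can be restricted to this
      set.\<close>
    let ?M = "mix_set E ?Y Z"
    have "?M \<subseteq> ?X"
    proof
      fix H assume "H \<in> ?M"
      then obtain Y' where Y': "Y' \<in> ?Y" "H = mix E Y' G" by (auto simp: mix_set_def mixZ)
      show "H \<in> ?X"
        unfolding memX
      proof (intro allI impI)
        fix F s assume s: "fmlookup ts F = Some s"
        show "\<exists>Y \<in> tree_gambles s. \<forall>\<omega> \<in> F. H \<omega> = Y \<omega>"
        proof (cases "F = E")
          case True
          then show ?thesis using s t Y' by (intro bexI[of _ Y']) (auto simp: mix_def)
        next
          case False
          then have "\<forall>\<omega> \<in> F. H \<omega> = G \<omega>" using disj[OF s] Y' by (auto simp: mix_def)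
          then show ?thesis using GX s unfolding memX by fastforce
        qed
      qed
    qed
    moreover have "G \<in> ?M"
    proof -
      obtain Y' where "Y' \<in> ?Y" "\<forall>\<omega> \<in> E. G \<omega> = Y' \<omega>"
        using GX t unfolding memX by blast
      moreover from this have "G = mix E Y' Z" unfolding mixZ by (auto simp: mix_def)
      ultimately show ?thesis by (auto simp: mix_set_def)
    qed
    moreover have "finite ?M" using Ys(1) by (simp add: mix_set_def)
    ultimately have "opt ?M A = opt ?X A \<inter> ?M"
      using int[unfolded intersection_property_def, rule_format, of A ?X ?M] A X G
        event_consistent_subset[OF X(3), of ?M] by blast
    moreover have "opt ?M A = mix_set E (opt ?Y (A \<inter> E)) Z"
      using mixt[unfolded mixture_property_def, rule_format, of E A Z ?Y] Zcon Ys False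
        cont[OF t] ne[OF t] by (simp add: Int_commute)
    moreover have "mix E Y G \<in> ?M"
      using Y by (auto simp: mix_set_def mixZ)
    ultimately have "mix E Y G \<in> opt ?X A \<longleftrightarrow> mix E Y Z \<in> mix_set E (opt ?Y (A \<inter> E)) Z"
      by (auto simp: mixZ Int_commute)
    also have "\<dots> \<longleftrightarrow> Y \<in> opt ?Y (A \<inter> E)"
    proof
      assume "mix E Y Z \<in> mix_set E (opt ?Y (A \<inter> E)) Z"
      then obtain X' where X': "X' \<in> opt ?Y (A \<inter> E)" "mix E Y Z = mix E X' Z"
        by (auto simp: mix_set_def)
      \<comment> \<open>Equal mixtures show equality on \<open>E\<close> only, so \<open>X'\<close>
        and \<open>Y\<close> may differ elsewhere; the conditioning property bridges this
        gap.\<close>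
      have "\<forall>\<omega> \<in> A \<inter> E. X' \<omega> = Y \<omega>"
        using X'(2) by (auto simp: mix_def fun_eq_iff) metis
      then show "Y \<in> opt ?Y (A \<inter> E)"
        using cond[unfolded conditioning_property_def, rule_format, of "A \<inter> E" ?Y X' Y]
          X'(1) Y Ys optY ne[OF t] cont[OF t] by blast
    qed (rule mix_in_mix_set)
    finally show ?thesis .
  qed
qed

text \<open>Every normal form decision of a chance node contains all its arcs, so \<open>ne\<close>
  suffices for the arc \<open>E\<close> to occur in a selected decision.\<close>

lemma st_set_norm_opt_Chance:
  fixes ts :: "('w::finite set, ('w, 'r) tree) fmap"
  assumes opt: "choice_function opt" and cond: "conditioning_property opt"
    and int: "intersection_property opt" and mixt: "mixture_property opt"
    and wf: "well_formed (Chance ts)" and con: "consistent (Chance ts, A)"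
    and t: "fmlookup ts E = Some t"
    and ne: "norm_opt opt (Chance ts, A) \<noteq> {}"
  shows "st_set [Inr E] (norm_opt opt (Chance ts, A)) = norm_opt opt (t, A \<inter> E)"
proof (intro equalityI subsetI)
  let ?X = "tree_gambles (Chance ts)" and ?Y = "tree_gambles t"
  note key = mix_mem_opt_Chance_iff[OF opt cond int mixt wf con t]
  have p: "partition_on UNIV (fset (fmdom ts))"
    using wf by (simp add: well_formed_Chance_iff)
  have wft: "well_formed t" using wf t by (auto simp: well_formed_Chance_iff)
  {
    fix S assume "S \<in> st_set [Inr E] (norm_opt opt (Chance ts, A))"
    then obtain us u where us: "fmrel normal_form ts us" "tree_gambles (Chance us) \<subseteq> opt ?X A"
        "fmlookup us E = Some u" "S = (u, A \<inter> E)"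
      by (auto simp: mem_st_set_iff mem_norm_opt_iff normal_form_Chance_iff split: option.splits)
    have p': "partition_on UNIV (fset (fmdom us))"
      using p fmrel_fmdom_eq[OF us(1)] by simp
    have "normal_form (Chance ts) (Chance us)"
      using us(1) by (simp add: normal_form_Chance_iff)
    then obtain G where G: "tree_gambles (Chance us) = {G}"
      using tree_gambles_normal_form wf by blast
    have nfu: "normal_form t u" using fmrel_lookup1[OF us(1) t] us(3) by auto
    then obtain Y where Y: "Y \<in> ?Y" "tree_gambles u = {Y}"
      using tree_gambles_normal_form wft by blast
    have "G \<in> tree_gambles (Chance us)" using G by simp
    then have "\<forall>\<omega> \<in> E. G \<omega> = Y \<omega>"
      using us(3) Y(2) unfolding mem_tree_gambles_Chance[OF p'] by fastforce
    \<comment> \<open>The gamble of the selected decision is its own mixture with the gamble of its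
      branch at \<open>E\<close>.\<close>
    then have "mix E Y G = G" by (auto simp: mix_def)
    then have "Y \<in> opt ?Y (A \<inter> E)"
      using key[of G Y] G us(2) Y(1) by simp
    then show "S \<in> norm_opt opt (t, A \<inter> E)"
      using us(4) nfu Y(2) by (auto simp: mem_norm_opt_iff)
  next
    fix S assume "S \<in> norm_opt opt (t, A \<inter> E)"
    then obtain u where u: "S = (u, A \<inter> E)" "normal_form t u" "tree_gambles u \<subseteq> opt ?Y (A \<inter> E)"
      by (auto simp: mem_norm_opt_iff)
    then obtain Y where Y: "Y \<in> ?Y" "tree_gambles u = {Y}"
      using tree_gambles_normal_form wft by blast
    obtain us where us: "fmrel normal_form ts us" "tree_gambles (Chance us) \<subseteq> opt ?X A"
      using ne by (auto simp: mem_norm_opt_iff normal_form_Chance_iff)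
    have "normal_form (Chance ts) (Chance us)"
      using us(1) by (simp add: normal_form_Chance_iff)
    then obtain G where G: "tree_gambles (Chance us) = {G}"
      using tree_gambles_normal_form wf by blast
    \<comment> \<open>An arbitrary selected decision supplies the other branches; exchanging its
      branch at \<open>E\<close> for \<open>u\<close> turns its gamble \<open>G\<close> into
      \<open>mix E Y G\<close>.\<close>
    let ?vs = "fmupd E u us"
    have rel: "fmrel normal_form ts ?vs"
    proof (rule fmrelI)
      fix F show "rel_option normal_form (fmlookup ts F) (fmlookup ?vs F)"
        using u(2) t fmrelD[OF us(1), of F] by auto
    qed
    then have nf: "normal_form (Chance ts) (Chance ?vs)"
      by (simp add: normal_form_Chance_iff)
    have p': "partition_on UNIV (fset (fmdom us))" "partition_on UNIV (fset (fmdom ?vs))"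
      using p fmrel_fmdom_eq[OF us(1)] fmrel_fmdom_eq[OF rel] by simp_all
    have "G \<in> tree_gambles (Chance us)" using G by simp
    then have Gv: "\<exists>Y' \<in> tree_gambles v. \<forall>\<omega> \<in> F. G \<omega> = Y' \<omega>" if "fmlookup us F = Some v" for F v
      using that unfolding mem_tree_gambles_Chance[OF p'(1)] by blast
    have "mix E Y G \<in> tree_gambles (Chance ?vs)"
      unfolding mem_tree_gambles_Chance[OF p'(2)]
    proof (intro allI impI)
      fix F v assume v: "fmlookup ?vs F = Some v"
      show "\<exists>Y' \<in> tree_gambles v. \<forall>\<omega> \<in> F. mix E Y G \<omega> = Y' \<omega>"
      proof (cases "F = E")
        case True
        then show ?thesis using v Y by (auto simp: mix_def)
      next
        case False
        have "F \<inter> E = {}"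
          using p'(2) fmdomI[OF v] False by (auto simp: partition_on_def disjoint_def)
        then have "\<forall>\<omega> \<in> F. mix E Y G \<omega> = G \<omega>" by (auto simp: mix_def)
        moreover obtain Y' where "Y' \<in> tree_gambles v" "\<forall>\<omega> \<in> F. G \<omega> = Y' \<omega>"
          using Gv[of F v] v False by auto
        ultimately show ?thesis by (intro bexI[of _ Y']) auto
      qed
    qed
    then have "tree_gambles (Chance ?vs) = {mix E Y G}"
      using tree_gambles_normal_form[OF nf wf] by auto
    moreover have "mix E Y G \<in> opt ?X A"
      using key[of G Y] G us(2) Y u(3) by simp
    ultimately have "(Chance ?vs, A) \<in> norm_opt opt (Chance ts, A)"
      using nf by (simp add: mem_norm_opt_iff)
    moreover have "subtree_at [Inr E] (Chance ?vs, A) = Some S"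
      using u(1) by simp
    ultimately show "S \<in> st_set [Inr E] (norm_opt opt (Chance ts, A))"
      unfolding mem_st_set_iff by blast
  }
qed

lemma subtree_perfect_norm_opt:
  fixes opt :: "('w::finite \<Rightarrow> 'r) set \<Rightarrow> 'w set \<Rightarrow> ('w \<Rightarrow> 'r) set"
  assumes "choice_function opt" "conditioning_property opt" "intersection_property opt"
    "mixture_property opt"
  shows "subtree_perfect (norm_opt opt)"
proof (rule subtree_perfectI[OF normal_form_operator_norm_opt])
  fix T a S U V
  assume T: "decision_tree T" "consistent T" and S: "subtree_at [a] T = Some S"
    and U: "U \<in> norm_opt opt T" and V: "subtree_at [a] U = Some V"
  obtain t A where T_eq: "T = (t, A)" by (cases T)
  have V_mem: "V \<in> st_set [a] (norm_opt opt T)"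
    using U V unfolding mem_st_set_iff by blast
  from S[unfolded T_eq] show "st_set [a] (norm_opt opt T) = norm_opt opt S"
  proof (cases rule: subtree_at_single_cases)
    case (1 ts i s)
    have "st_set [Inl i] (norm_opt opt (Decision ts, A)) = norm_opt opt (s, A)"
      using T 1 assms(3) V_mem by (intro st_set_norm_opt_Decision) (auto simp: T_eq decision_tree_def)
    then show ?thesis using 1 by (simp add: T_eq)
  next
    case (2 ts E s)
    have "st_set [Inr E] (norm_opt opt (Chance ts, A)) = norm_opt opt (s, A \<inter> E)"
      using T 2 assms U by (intro st_set_norm_opt_Chance) (auto simp: T_eq decision_tree_def)
    then show ?thesis using 2 by (simp add: T_eq)
  qed
qed

section \<open>Subtree perfectness implies the three properties\<close>

text \<open>The tree is a chance node over the level sets of \<open>X\<close> with one leaf for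
  each. Event consistency says exactly that \<open>A\<close> meets every level set, which makes this
  tree consistent.\<close>

lemma ex_tree_gambles_singleton:
  fixes X :: "('w::finite, 'r) gamble"
  assumes "A \<noteq> {}" "event_consistent A {X}"
  shows "\<exists>t. well_formed t \<and> consistent (t, A) \<and> tree_gambles t = {X}"
proof -
  let ?K = "range (\<lambda>\<omega>. X -` {X \<omega>})"
  obtain m :: "('w set, ('w, 'r) tree) fmap" where
    m: "\<And>E. fmlookup m E = (if E \<in> ?K then Some (Leaf (X (SOME \<omega>. \<omega> \<in> E))) else None)"
    by (rule ex_fmap_on_finite[of ?K "\<lambda>E. Leaf (X (SOME \<omega>. \<omega> \<in> E))"]) auto
  \<comment> \<open>\<open>X\<close> is constant on a level set, so the reward read off at the
    chosen point is the right one.\<close>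
  have val: "X (SOME \<omega>'. \<omega>' \<in> E) = X \<omega>" if "E \<in> ?K" "\<omega> \<in> E" for E \<omega>
    using someI[of "\<lambda>\<omega>'. \<omega>' \<in> E", OF that(2)] that by auto
  have "fset (fmdom m) = ?K"
    by (auto simp: set_eq_iff mem_fmdom_iff m split: if_splits)
  moreover have "partition_on UNIV ?K"
    by (auto simp: partition_on_def disjoint_def)
  ultimately have p: "partition_on UNIV (fset (fmdom m))" by simp
  have "well_formed (Chance m)"
    using p by (auto simp: well_formed_Chance_iff m split: if_splits)
  moreover have "consistent (Chance m, A)"
  proof (rule consistent_ChanceI[OF assms(1)])
    fix E t assume "fmlookup m E = Some t"
    then obtain r \<omega> where t: "t = Leaf r" "E = X -` {X \<omega>}" by (auto simp: m split: if_splits)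
    then have "A \<inter> E \<noteq> {}"
      using assms(2) by (auto simp: event_consistent_def)
    then show "consistent (t, A \<inter> E)"
      by (simp add: t(1) consistent_Leaf)
  qed
  moreover have "Y \<in> tree_gambles (Chance m) \<longleftrightarrow> Y = X" for Y
  proof
    assume "Y = X"
    then show "Y \<in> tree_gambles (Chance m)"
      unfolding mem_tree_gambles_Chance[OF p] using val by (auto simp: m split: if_splits)
  next
    assume Y: "Y \<in> tree_gambles (Chance m)"
    show "Y = X"
    proof
      fix \<omega>
      have "fmlookup m (X -` {X \<omega>}) = Some (Leaf (X (SOME \<omega>'. \<omega>' \<in> X -` {X \<omega>})))"
        by (simp add: m)
      then show "Y \<omega> = X \<omega>"
        using Y val[of "X -` {X \<omega>}" \<omega>] unfolding mem_tree_gambles_Chance[OF p] by fastforce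
    qed
  qed
  ultimately show ?thesis by blast
qed

text \<open>A decision node over one tree for each gamble.\<close>

lemma ex_tree_gambles:
  fixes \<X> :: "('w::finite, 'r) gamble set"
  assumes "A \<noteq> {}" "finite \<X>" "\<X> \<noteq> {}" "event_consistent A \<X>"
  shows "\<exists>t. well_formed t \<and> consistent (t, A) \<and> tree_gambles t = \<X>"
proof -
  have "\<forall>X \<in> \<X>. \<exists>t. well_formed t \<and> consistent (t, A) \<and> tree_gambles t = {X}"
    using assms by (intro ballI ex_tree_gambles_singleton) (auto simp: event_consistent_def)
  then obtain f where
    f: "\<And>X. X \<in> \<X> \<Longrightarrow> well_formed (f X) \<and> consistent (f X, A) \<and> tree_gambles (f X) = {X}"
    by metis
  \<comment> \<open>Arcs are named by natural numbers, so the finite set of gambles is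
    enumerated.\<close>
  obtain h where h: "bij_betw h {0..<card \<X>} \<X>"
    using ex_bij_betw_nat_finite[OF assms(2)] by blast
  obtain m where m: "\<And>i. fmlookup m i = (if i \<in> {0..<card \<X>} then Some (f (h i)) else None)"
    by (rule ex_fmap_on_finite[of "{0..<card \<X>}" "\<lambda>i. f (h i)"]) auto
  have lookup: "fmlookup m i = Some t \<longleftrightarrow> i \<in> {0..<card \<X>} \<and> t = f (h i)" for i t
    by (auto simp: m)
  have img: "h ` {0..<card \<X>} = \<X>" using h by (simp add: bij_betw_def)
  then have hX: "h i \<in> \<X>" if "i < card \<X>" for i using that by auto
  have "0 < card \<X>" using assms(2,3) by (simp add: card_gt_0_iff)
  then have "m \<noteq> fmempty" using m[of 0] by auto
  then have "well_formed (Decision m)"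
    using f hX by (auto simp: well_formed_Decision_iff lookup)
  moreover have "consistent (Decision m, A)"
    using f hX assms(1) by (intro consistent_DecisionI) (auto simp: lookup)
  moreover have "X \<in> tree_gambles (Decision m) \<longleftrightarrow> X \<in> \<X>" for X
  proof -
    have "X \<in> tree_gambles (Decision m) \<longleftrightarrow> (\<exists>i < card \<X>. X \<in> tree_gambles (f (h i)))"
      unfolding mem_tree_gambles_Decision lookup by auto
    also have "\<dots> \<longleftrightarrow> (\<exists>i < card \<X>. X = h i)"
      using f hX by auto
    also have "\<dots> \<longleftrightarrow> X \<in> h ` {0..<card \<X>}"
      by auto
    finally show ?thesis by (simp only: img)
  qed
  ultimately show ?thesis by blast
qed

section \<open>Chance nodes with two arcs\<close>

abbreviation chance2 :: "'w set \<Rightarrow> ('w, 'r) tree \<Rightarrow> ('w, 'r) tree \<Rightarrow> ('w, 'r) tree" where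
  "chance2 A t s \<equiv> Chance (fmupd A t (fmupd (- A) s fmempty))"

lemma partition_on_chance2:
  assumes "A \<noteq> {}" "- A \<noteq> {}"
  shows "partition_on UNIV (fset (fmdom (fmupd A t (fmupd (- A) s fmempty))))"
  using assms by (auto simp: partition_on_def disjoint_def)

lemma tree_gambles_chance2:
  assumes "A \<noteq> {}" "- A \<noteq> {}" "tree_gambles s = {Z}"
  shows "tree_gambles (chance2 A t s) = mix_set A (tree_gambles t) Z"
proof -
  \<comment> \<open>The two arcs have different labels, so neither update overwrites the
    other.\<close>
  have "A \<noteq> - A" using assms(1) by blast
  then have "G \<in> tree_gambles (chance2 A t s) \<longleftrightarrow>
      (\<exists>X \<in> tree_gambles t. \<forall>\<omega> \<in> A. G \<omega> = X \<omega>) \<and> (\<forall>\<omega> \<in> - A. G \<omega> = Z \<omega>)" for G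
    unfolding mem_tree_gambles_Chance[OF partition_on_chance2[OF assms(1,2)]]
    using assms(3) by auto
  moreover have "G \<in> mix_set A (tree_gambles t) Z \<longleftrightarrow>
      (\<exists>X \<in> tree_gambles t. \<forall>\<omega> \<in> A. G \<omega> = X \<omega>) \<and> (\<forall>\<omega> \<in> - A. G \<omega> = Z \<omega>)" for G
    by (auto simp: mix_set_def mix_def fun_eq_iff)
  ultimately show ?thesis by blast
qed

text \<open>Subtree perfectness of a two-arc chance node at the arc \<open>A\<close>. The other
  branch has the single gamble \<open>Z\<close>, so the gambles of the node are mixtures with
  \<open>Z\<close>. Both the mixture and the conditioning property are derived from it.\<close>

lemma mix_mem_opt_iff:
  fixes opt :: "('w::finite \<Rightarrow> 'r) set \<Rightarrow> 'w set \<Rightarrow> ('w \<Rightarrow> 'r) set"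
  assumes opt: "choice_function opt" and sp: "subtree_perfect (norm_opt opt)"
    and A: "A \<noteq> {}" "- A \<noteq> {}"
    and t: "well_formed t" "consistent (t, B \<inter> A)"
    and s: "well_formed s" "consistent (s, B \<inter> - A)" "tree_gambles s = {Z}"
    and X: "X \<in> tree_gambles t"
  shows "mix A X Z \<in> opt (mix_set A (tree_gambles t) Z) B \<longleftrightarrow> X \<in> opt (tree_gambles t) (B \<inter> A)"
proof -
  let ?T = "chance2 A t s" and ?M = "mix_set A (tree_gambles t) Z"
  have AA: "A \<noteq> - A" using A by blast
  have gT: "tree_gambles ?T = ?M" by (rule tree_gambles_chance2[OF A s(3)])
  have wf: "well_formed ?T"
    unfolding well_formed_Chance_iff using partition_on_chance2[OF A] t s by auto
  have B: "B \<noteq> {}" using consistent_nonempty[OF t(2)] by blast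
  have con: "consistent (?T, B)"
    using B t s by (intro consistent_ChanceI) (auto split: if_splits)
  have "finite ?M" "?M \<noteq> {}"
    using finite_tree_gambles[OF wf] tree_gambles_nonempty[OF wf] by (simp_all add: gT)
  then have optM: "opt ?M B \<noteq> {}" "opt ?M B \<subseteq> ?M"
    using opt B unfolding choice_function_def by blast+
  \<comment> \<open>Subtree perfectness concerns only nodes of selected decisions. A choice function
    selects something, and any decision selected here contains the arc \<open>A\<close>.\<close>
  then obtain G v where v: "G \<in> opt ?M B" "normal_form ?T v" "tree_gambles v = {G}"
    using ex_normal_form[OF wf] gT by blast
  then obtain us where us: "v = Chance us" "fmrel normal_form (fmupd A t (fmupd (- A) s fmempty)) us"
    by (auto simp: normal_form_Chance_iff)
  have "(v, B) \<in> norm_opt opt (?T, B)"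
    using v gT by (simp add: mem_norm_opt_iff)
  moreover have "[Inr A] \<in> nodes (v, B)"
    using fmrel_lookup1[OF us(2), of A] us(1) by (auto simp: nodes_def)
  ultimately have st_eq: "st_set [Inr A] (norm_opt opt (?T, B)) = norm_opt opt (t, B \<inter> A)"
    using wf con by (intro subtree_perfectD[OF sp]) (auto simp: decision_tree_def)
  obtain u where u: "normal_form t u" "tree_gambles u = {X}"
    using ex_normal_form[OF t(1) X] by blast
  obtain r where r: "normal_form s r" "tree_gambles r = {Z}"
    using ex_normal_form[OF s(1), of Z] s(3) by blast
  show ?thesis
  proof
    assume mix: "mix A X Z \<in> opt ?M B"
    have "fmrel normal_form (fmupd A t (fmupd (- A) s fmempty)) (fmupd A u (fmupd (- A) r fmempty))"
      using u r by (intro fmrel_upd) auto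
    then have "normal_form ?T (chance2 A u r)"
      by (simp add: normal_form_Chance_iff)
    moreover have "tree_gambles (chance2 A u r) = {mix A X Z}"
      unfolding tree_gambles_chance2[OF A r(2)] by (simp add: u(2) mix_set_def)
    ultimately have "(chance2 A u r, B) \<in> norm_opt opt (?T, B)"
      using mix gT by (simp add: mem_norm_opt_iff)
    moreover have "subtree_at [Inr A] (chance2 A u r, B) = Some (u, B \<inter> A)" by simp
    ultimately have "(u, B \<inter> A) \<in> norm_opt opt (t, B \<inter> A)"
      unfolding st_eq[symmetric] mem_st_set_iff by blast
    then show "X \<in> opt (tree_gambles t) (B \<inter> A)"
      using u(2) by (simp add: mem_norm_opt_iff)
  next
    assume "X \<in> opt (tree_gambles t) (B \<inter> A)"
    then have "(u, B \<inter> A) \<in> norm_opt opt (t, B \<inter> A)"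
      using u by (simp add: mem_norm_opt_iff)
    then obtain U where U: "U \<in> norm_opt opt (?T, B)" "subtree_at [Inr A] U = Some (u, B \<inter> A)"
      unfolding st_eq[symmetric] mem_st_set_iff by blast
    then obtain ws where ws: "U = (Chance ws, B)" "normal_form ?T (Chance ws)"
        "tree_gambles (Chance ws) \<subseteq> opt ?M B"
        "fmrel normal_form (fmupd A t (fmupd (- A) s fmempty)) ws"
      unfolding mem_norm_opt_iff gT normal_form_Chance_iff by blast
    obtain H where H: "H \<in> ?M" "tree_gambles (Chance ws) = {H}"
      using tree_gambles_normal_form[OF ws(2) wf] gT by blast
    have lookup: "fmlookup ws A = Some u"
      using U(2) ws(1) by (auto split: option.splits)
    have p: "partition_on UNIV (fset (fmdom ws))"
      unfolding fmrel_fmdom_eq[OF ws(4), symmetric] by (rule partition_on_chance2[OF A])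
    have "H \<in> tree_gambles (Chance ws)" using H by simp
    then have "\<forall>\<omega> \<in> A. H \<omega> = X \<omega>"
      using lookup u(2) unfolding mem_tree_gambles_Chance[OF p] by fastforce
    \<comment> \<open>\<open>H\<close> equals \<open>Z\<close> outside \<open>A\<close> because it
      is a member of \<open>?M\<close>.\<close>
    then have "H = mix A X Z"
      using H(1) by (auto simp: mix_set_def mix_def fun_eq_iff)
    then show "mix A X Z \<in> opt ?M B" using H ws(3) by simp
  qed
qed

lemma intersection_property_if_subtree_perfect:
  fixes opt :: "('w::finite \<Rightarrow> 'r) set \<Rightarrow> 'w set \<Rightarrow> ('w \<Rightarrow> 'r) set"
  assumes opt: "choice_function opt" and sp: "subtree_perfect (norm_opt opt)"
  shows "intersection_property opt"
  unfolding intersection_property_def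
proof (intro allI impI; elim conjE)
  fix A :: "'w set" and \<X> \<Y> :: "('w \<Rightarrow> 'r) set"
  assume A: "A \<noteq> {}" and X: "finite \<X>" "\<X> \<noteq> {}" "event_consistent A \<X>"
    and Y: "finite \<Y>" "\<Y> \<noteq> {}" "event_consistent A \<Y>" and sub: "\<Y> \<subseteq> \<X>"
    and ne: "opt \<X> A \<inter> \<Y> \<noteq> {}"
  obtain tx where tx: "well_formed tx" "consistent (tx, A)" "tree_gambles tx = \<X>"
    using ex_tree_gambles[OF A X] by blast
  obtain ty where ty: "well_formed ty" "consistent (ty, A)" "tree_gambles ty = \<Y>"
    using ex_tree_gambles[OF A Y] by blast
  \<comment> \<open>Because \<Y> is a subset of \<X>, the extra branch \<open>ty\<close> leaves the
    gambles of the tree equal to \<X>, while a subtree now has exactly the gambles \<Y>.\<close>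
  define ts where "ts = fmupd (0::nat) ty (fmupd 1 tx fmempty)"
  have lookup: "fmlookup ts i = Some t \<longleftrightarrow> i = 0 \<and> t = ty \<or> i = 1 \<and> t = tx" for i t
    by (auto simp: ts_def)
  have "ts \<noteq> fmempty"
    using lookup[of 0 ty] by auto
  then have wf: "well_formed (Decision ts)"
    using tx ty by (auto simp: well_formed_Decision_iff lookup)
  have con: "consistent (Decision ts, A)"
    using A tx ty by (intro consistent_DecisionI) (auto simp: lookup)
  have g: "tree_gambles (Decision ts) = \<X>"
    using sub tx ty by (auto simp: set_eq_iff mem_tree_gambles_Decision lookup)
  \<comment> \<open>The premise of the intersection property places arc 0 in a selected
    decision.\<close>
  obtain X0 u0 where u0: "X0 \<in> opt \<X> A" "normal_form ty u0" "tree_gambles u0 = {X0}"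
    using ne ex_normal_form[OF ty(1)] ty(3) by blast
  have "(u0, A) \<in> st_set [Inl 0] (norm_opt opt (Decision ts, A))"
    unfolding mem_st_set_norm_opt_Decision g using u0 lookup by auto
  then obtain U where "U \<in> norm_opt opt (Decision ts, A)" "[Inl 0] \<in> nodes U"
    by (auto simp: st_set_def)
  moreover have "subtree_at [Inl 0] (Decision ts, A) = Some (ty, A)"
    using lookup[of 0 ty] by simp
  ultimately have st_eq: "st_set [Inl 0] (norm_opt opt (Decision ts, A)) = norm_opt opt (ty, A)"
    using wf con by (intro subtree_perfectD[OF sp]) (auto simp: decision_tree_def)
  have "Z \<in> opt \<Y> A \<longleftrightarrow> Z \<in> opt \<X> A" if Z: "Z \<in> \<Y>" for Z
  proof -
    obtain u where u: "normal_form ty u" "tree_gambles u = {Z}"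
      using ex_normal_form[OF ty(1), of Z] ty(3) Z by auto
    have "Z \<in> opt \<Y> A \<longleftrightarrow> (u, A) \<in> norm_opt opt (ty, A)"
      using u ty(3) by (simp add: mem_norm_opt_iff)
    also have "\<dots> \<longleftrightarrow> Z \<in> opt \<X> A"
      unfolding st_eq[symmetric] mem_st_set_norm_opt_Decision g using u lookup by auto
    finally show ?thesis .
  qed
  moreover have "opt \<Y> A \<subseteq> \<Y>"
    using opt Y A unfolding choice_function_def by blast
  ultimately show "opt \<Y> A = opt \<X> A \<inter> \<Y>" by blast
qed

text \<open>Mixed with the same gamble outside \<open>A\<close>, \<open>X\<close> and
  \<open>Y\<close> coincide, so a choice from this single option must select it. By
  \<open>mix_mem_opt_iff\<close>, \<open>Y\<close> is optimal in \<open>{X, Y}\<close>, and the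
  intersection property, already derived, lifts this to \<X>.\<close>

lemma conditioning_property_if_subtree_perfect:
  fixes opt :: "('w::finite \<Rightarrow> 'r) set \<Rightarrow> 'w set \<Rightarrow> ('w \<Rightarrow> 'r) set"
  assumes opt: "choice_function opt" and sp: "subtree_perfect (norm_opt opt)"
  shows "conditioning_property opt"
  unfolding conditioning_property_def
proof (intro allI impI ballI; elim conjE)
  fix A :: "'w set" and \<X> X Y
  assume A: "A \<noteq> {}" and X: "finite \<X>" "\<X> \<noteq> {}" "event_consistent A \<X>"
    and XY: "X \<in> \<X>" "Y \<in> \<X>" "\<forall>\<omega> \<in> A. X \<omega> = Y \<omega>" and optX: "X \<in> opt \<X> A"
  show "Y \<in> opt \<X> A"
  proof (cases "- A = {}")
    case True
    then have "X = Y" using XY(3) by auto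
    then show ?thesis using optX by simp
  next
    case False
    have sub: "{X, Y} \<subseteq> \<X>" using XY by simp
    have con: "event_consistent A {X, Y}" using X(3) sub by (rule event_consistent_subset)
    obtain t where t: "well_formed t" "consistent (t, UNIV \<inter> A)" "tree_gambles t = {X, Y}"
      using ex_tree_gambles[OF A _ _ con] by auto
    \<comment> \<open>Any constant reward serves outside \<open>A\<close>; a leaf is consistent
      there because \<open>- A\<close> is non-empty. The two-arc node carries the event
      \<open>UNIV\<close>.\<close>
    define s :: "('w, 'r) tree" where "s = Leaf undefined"
    define Z :: "('w, 'r) gamble" where "Z = (\<lambda>_. undefined)"
    have s: "well_formed s" "consistent (s, UNIV \<inter> - A)" "tree_gambles s = {Z}"
      using False by (simp_all add: s_def Z_def consistent_Leaf)
    have "mix A X Z = mix A Y Z" using XY(3) by (auto simp: mix_def)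
    then have "mix_set A {X, Y} Z = {mix A Y Z}" by (auto simp: mix_set_def)
    moreover have "opt {mix A Y Z} UNIV = {mix A Y Z}"
      using opt unfolding choice_function_def
      by (metis UNIV_not_empty finite.emptyI finite.insertI insert_not_empty subset_singletonD)
    ultimately have "Y \<in> opt {X, Y} A"
      using mix_mem_opt_iff[OF opt sp A False t(1,2) s, of Y] t(3) by simp
    \<comment> \<open>The optimality of \<open>X\<close> in \<X> is what makes the intersection
      non-empty.\<close>
    moreover have "opt {X, Y} A = opt \<X> A \<inter> {X, Y}"
      using intersection_property_if_subtree_perfect[OF opt sp, unfolded intersection_property_def,
          rule_format, of A \<X> "{X, Y}"] A X con sub optX by auto
    ultimately show ?thesis by blast
  qed
qed

lemma mixture_property_if_subtree_perfect:
  fixes opt :: "('w::finite \<Rightarrow> 'r) set \<Rightarrow> 'w set \<Rightarrow> ('w \<Rightarrow> 'r) set"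
  assumes opt: "choice_function opt" and sp: "subtree_perfect (norm_opt opt)"
  shows "mixture_property opt"
  unfolding mixture_property_def
proof (intro allI impI; elim conjE)
  fix A B :: "'w set" and Z :: "'w \<Rightarrow> 'r" and \<X> :: "('w \<Rightarrow> 'r) set"
  assume A: "A \<inter> B \<noteq> {}" "- A \<inter> B \<noteq> {}" and Z: "event_consistent (- A \<inter> B) {Z}"
    and X: "finite \<X>" "\<X> \<noteq> {}" "event_consistent (A \<inter> B) \<X>"
  obtain t where t: "well_formed t" "consistent (t, B \<inter> A)" "tree_gambles t = \<X>"
    using ex_tree_gambles[OF A(1) X] unfolding Int_commute[of A] by blast
  obtain s where s: "well_formed s" "consistent (s, B \<inter> - A)" "tree_gambles s = {Z}"
    using ex_tree_gambles_singleton[OF A(2) Z] unfolding Int_commute[of "- A"] by blast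
  have A': "A \<noteq> {}" "- A \<noteq> {}" using A by auto
  have iff: "mix A X Z \<in> opt (mix_set A \<X> Z) B \<longleftrightarrow> X \<in> opt \<X> (A \<inter> B)" if "X \<in> \<X>" for X
    using mix_mem_opt_iff[OF opt sp A' t(1,2) s, of X] that t(3) by (simp add: Int_commute)
  have M: "finite (mix_set A \<X> Z)" "mix_set A \<X> Z \<noteq> {}" "B \<noteq> {}"
    using X A by (auto simp: mix_set_def)
  \<comment> \<open>\<open>iff\<close> speaks only of gambles in \<X> and their mixtures; these
    inclusions ensure that all selected gambles are of this kind.\<close>
  note sub = choice_functionD(2)[OF opt M] choice_functionD(2)[OF opt X(1,2) A(1)]
  show "opt (mix_set A \<X> Z) B = mix_set A (opt \<X> (A \<inter> B)) Z"
  proof (intro equalityI subsetI)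
    fix G assume G: "G \<in> opt (mix_set A \<X> Z) B"
    then obtain X where "X \<in> \<X>" "G = mix A X Z" using sub(1) by (auto simp: mix_set_def)
    then show "G \<in> mix_set A (opt \<X> (A \<inter> B)) Z"
      using G iff by (auto simp: mix_set_def)
  next
    fix G assume "G \<in> mix_set A (opt \<X> (A \<inter> B)) Z"
    then obtain X where "X \<in> opt \<X> (A \<inter> B)" "G = mix A X Z" by (auto simp: mix_set_def)
    then show "G \<in> opt (mix_set A \<X> Z) B"
      using iff sub(2) by blast
  qed
qed

theorem theorem22:
  fixes opt :: "('w::finite \<Rightarrow> 'r) set \<Rightarrow> 'w set \<Rightarrow> ('w \<Rightarrow> 'r) set"
  assumes "choice_function opt"
  shows "subtree_perfect (norm_opt opt) \<longleftrightarrow>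
    conditioning_property opt \<and> intersection_property opt \<and> mixture_property opt"
  using assms subtree_perfect_norm_opt intersection_property_if_subtree_perfect
    conditioning_property_if_subtree_perfect mixture_property_if_subtree_perfect
  by blast

end
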